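(* In any primitive integral Apollonian packing, whose Descartes quadruples satisfy $a+b+c+d>0$, the Descartes quadruples modulo $12$ all fall in exactly one of four possible orbits. The first orbit $Y\ (\bmod\ 12)$ consists of all permutations of $$\{(0,0,1,1),\ (0,1,1,4),\ (0,1,4,9),\ (1,4,4,9),\ (4,4,9,9)\}\ (\bmod\ 12).$$ The other three orbits are $(3,3,3,3)-Y$, $(6,6,6,6)+Y$ and $(9,9,9,9)-Y\ (\bmod\ 12)$.
   Context: A Descartes quadruple is $(a,b,c,d)$ with $2(a^2+b^2+c^2+d^2)=(a+b+c+d)^2$. The Apollonian group $\mathcal A$ is generated by $S_1,S_2,S_3,S_4$, where $S_i$ sends a column vector $(v_1,v_2,v_3,v_4)^T$ to the vector with $v_i$ replaced by $2\sum_{j\ne i}v_j-v_i$ and other entries unchanged. A Descartes configuration is a set of four mutually tangent circles (straight lines allowed, with curvature $0$) with disjoint interiors; an enclosing circle has its exterior as "interior" and is given negative curvature. An Apollonian circle packing is a packing of circles constructed from an initial Descartes configuration by repeatedly filling the interstices between mutually tangent circles with further tangent circles. The Descartes quadruples of the packing are the (unordered) curvature quadruples of its Descartes configurations; these are, up to ordering, the vectors $M\mathbf v$, $M\in\mathcal A$, for any one Descartes quadruple $\mathbf v$ of the packing. The packing is integral if all curvatures are integers, and primitive integral if moreover its Descartes quadruples have gcd $1$. "Orbit" means orbit modulo $12$ under the action of the Apollonian group on unordered quadruples (i.e. quadruples up to permutation of the entries). The sets $(k,k,k,k)\pm Y$ are $\{(k,k,k,k)\pm y: y\in Y\}$ modulo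 $12$. *)

theory Defs
  imports "HOL-Analysis.Analysis" "HOL-Algebra.Bij" "HOL-Algebra.Generated_Groups"
begin

section \<open>Circles and Descartes configurations\<close>

text \<open>
  A circle or straight line together with the side that counts as its interior:
  the disc of centre \<open>c\<close> and radius \<open>r\<close>, the exterior of such a disc
  (for an enclosing circle), or the open half-plane of the points \<open>z\<close> with
  \<open>n \<bullet> z > h\<close>.  The conditions \<open>r > 0\<close> and \<open>norm n = 1\<close> make the
  representation unique.
\<close>

datatype gcircle =
    Disc complex real
  | Exterior complex real
  | Halfplane complex real

fun proper :: "gcircle \<Rightarrow> bool" where
  "proper (Disc c r) \<longleftrightarrow> r > 0"
| "proper (Exterior c r) \<longleftrightarrow> r > 0"
| "proper (Halfplane n h) \<longleftrightarrow> norm n = 1"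

fun curvature :: "gcircle \<Rightarrow> real" where
  "curvature (Disc c r) = 1 / r"
| "curvature (Exterior c r) = - 1 / r"
| "curvature (Halfplane n h) = 0"

fun circle_interior :: "gcircle \<Rightarrow> complex set" where
  "circle_interior (Disc c r) = ball c r"
| "circle_interior (Exterior c r) = - cball c r"
| "circle_interior (Halfplane n h) = {z. n \<bullet> z > h}"

text \<open>
  The points of the circle in the extended plane, where \<open>None\<close> is the point at
  infinity; it lies on every straight line.
\<close>

fun locus :: "gcircle \<Rightarrow> complex option set" where
  "locus (Disc c r) = Some ` sphere c r"
| "locus (Exterior c r) = Some ` sphere c r"
| "locus (Halfplane n h) = insert None (Some ` {z. n \<bullet> z = h})"

text \<open>In particular, two lines are tangent (at infinity) iff they are distinct and parallel.\<close>

definition tangent :: "gcircle \<Rightarrow> gcircle \<Rightarrow> bool" where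
  "tangent C C' \<longleftrightarrow> (\<exists>!p. p \<in> locus C \<inter> locus C')"

definition descartes_configuration :: "gcircle set \<Rightarrow> bool" where
  "descartes_configuration D \<longleftrightarrow>
     card D = 4 \<and> (\<forall>C\<in>D. proper C) \<and>
     pairwise tangent D \<and>
     pairwise (\<lambda>C C'. disjnt (circle_interior C) (circle_interior C')) D"


section \<open>Apollonian packings and their Descartes quadruples\<close>

text \<open>
  A circle that fills an interstice between three mutually tangent circles is one that
  completes them to a Descartes configuration.
\<close>

inductive_set generated_packing :: "gcircle set \<Rightarrow> gcircle set" for D where
  init: "C \<in> D \<Longrightarrow> C \<in> generated_packing D"
| fill: "\<lbrakk>C1 \<in> generated_packing D; C2 \<in> generated_packing D; C3 \<in> generated_packing D;
          descartes_configuration {C1, C2, C3, C}\<rbrakk> \<Longrightarrow> C \<in> generated_packing D"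

definition apollonian_packing :: "gcircle set \<Rightarrow> bool" where
  "apollonian_packing P \<longleftrightarrow> (\<exists>D. descartes_configuration D \<and> P = generated_packing D)"

text \<open>Unordered quadruples are multisets of size 4.\<close>

definition curvature_quadruples :: "gcircle set \<Rightarrow> real multiset set" where
  "curvature_quadruples P =
     {image_mset curvature (mset_set D) | D. D \<subseteq> P \<and> descartes_configuration D}"

definition integral_packing :: "gcircle set \<Rightarrow> bool" where
  "integral_packing P \<longleftrightarrow> apollonian_packing P \<and> (\<forall>C\<in>P. curvature C \<in> \<int>)"

definition descartes_quadruples :: "gcircle set \<Rightarrow> int multiset set" where
  "descartes_quadruples P = {q. image_mset of_int q \<in> curvature_quadruples P}"

definition primitive_integral_packing :: "gcircle set \<Rightarrow> bool" where
  "primitive_integral_packing P \<longleftrightarrow>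
     integral_packing P \<and> (\<forall>q\<in>descartes_quadruples P. Gcd (set_mset q) = 1)"


section \<open>The Apollonian group and its orbits modulo 12\<close>

definition S :: "4 \<Rightarrow> int ^ 4 \<Rightarrow> int ^ 4" where
  "S i v = (\<chi> j. if j = i then 2 * (\<Sum>k\<in>UNIV - {i}. v $ k) - v $ i else v $ j)"

definition apollonian_group :: "(int ^ 4 \<Rightarrow> int ^ 4) set" where
  "apollonian_group = generate (BijGroup UNIV) (range S)"

definition unordered :: "int ^ 4 \<Rightarrow> int multiset" where
  "unordered v = image_mset (\<lambda>i. v $ i) (mset_set UNIV)"

definition mod12 :: "int multiset \<Rightarrow> int multiset" where
  "mod12 q = image_mset (\<lambda>x. x mod 12) q"

text \<open>
  The group acts on ordered quadruples, so the orbit of an unordered quadruple consists of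
  the images of all its orderings (and of all integer lifts of its residues).
\<close>

definition orbit12 :: "int multiset \<Rightarrow> int multiset set" where
  "orbit12 q =
     {mod12 (unordered (g v)) | g v. g \<in> apollonian_group \<and> mod12 (unordered v) = mod12 q}"

definition orbits12 :: "int multiset set set" where
  "orbits12 = {orbit12 q | q. size q = 4}"

definition Y :: "int multiset set" where
  "Y = {{#0,0,1,1#}, {#0,1,1,4#}, {#0,1,4,9#}, {#1,4,4,9#}, {#4,4,9,9#}}"

definition const_plus :: "int \<Rightarrow> int multiset set \<Rightarrow> int multiset set" where
  "const_plus k A = (\<lambda>q. mod12 (image_mset (\<lambda>y. k + y) q)) ` A"

definition const_minus :: "int \<Rightarrow> int multiset set \<Rightarrow> int multiset set" where
  "const_minus k A = (\<lambda>q. mod12 (image_mset (\<lambda>y. k - y) q)) ` A"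

end

theory Submission
  imports Defs "HOL-Number_Theory.Residues"
begin

text \<open>
  Quadruples modulo 12 are pinned down by their residues modulo 3 and 4.  Modulo 3 the
  Descartes equation alone suffices.  Modulo 4 it leaves the pairs \<open>0, 1\<close> and \<open>2, 3\<close>
  together with the pairs \<open>1, 2\<close> and \<open>3, 0\<close>, which are excluded by the sign condition:
  with \<open>m = (a + b + c - d) / 2\<close> the equation reads \<open>(a + b) (a + c) = a\<^sup>2 + m\<^sup>2\<close>, so by
  primitivity every prime congruent to 3 modulo 4 has even exponent in \<open>a + b \<ge> 0\<close>, whence
  \<open>a + b\<close> is not congruent to 3 modulo 4.

  All quadruples of one packing lie in the same orbit because three entries of a quadruple
  already determine its orbit, and a new circle completes three old ones to a quadruple.
\<close>

section \<open>The Descartes circle theorem\<close>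

text \<open>
  A circle of curvature \<open>k\<close>, centre \<open>c\<close> and radius \<open>r\<close> is sent to
  \<open>(k c, k, k (\<bar>c\<bar>\<^sup>2 - r\<^sup>2))\<close>, extended to lines by continuity and with the sign reversed for
  exteriors.  The images are unit vectors for the Lorentz form below, and externally tangent
  circles have product \<open>- 1\<close>.
\<close>

fun curv_centre :: "gcircle \<Rightarrow> complex" where
  "curv_centre (Disc c r) = c /\<^sub>R r"
| "curv_centre (Exterior c r) = - (c /\<^sub>R r)"
| "curv_centre (Halfplane n h) = n"

fun co_curvature :: "gcircle \<Rightarrow> real" where
  "co_curvature (Disc c r) = (c \<bullet> c - r\<^sup>2) / r"
| "co_curvature (Exterior c r) = - (c \<bullet> c - r\<^sup>2) / r"
| "co_curvature (Halfplane n h) = 2 * h"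

definition lorentz :: "gcircle \<Rightarrow> gcircle \<Rightarrow> real" where
  "lorentz C C' = curv_centre C \<bullet> curv_centre C' -
     (curvature C * co_curvature C' + co_curvature C * curvature C') / 2"

lemma lorentz_commute: "lorentz C C' = lorentz C' C"
  by (simp add: lorentz_def inner_commute algebra_simps)

lemma lorentz_self:
  assumes "proper C"
  shows "lorentz C C = 1"
  using assms by (cases C) (auto simp: lorentz_def field_simps power2_eq_square dot_square_norm)

lemma dist_sq: "(dist c c')\<^sup>2 = c \<bullet> c + c' \<bullet> c' - 2 * (c \<bullet> c')" for c c' :: complex
  by (simp add: dist_norm power2_norm_eq_inner inner_diff inner_commute)

text \<open>By the law of cosines this is the cosine of the angle opposite the segment of centres in
  a triangle with sides \<open>r\<close> and \<open>r'\<close>. External tangency gives - 1,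
  internal tangency 1.\<close>

lemma lorentz_Disc_Disc:
  assumes "r > 0" "r' > 0"
  shows "lorentz (Disc c r) (Disc c' r') = (r\<^sup>2 + r'\<^sup>2 - (dist c c')\<^sup>2) / (2 * r * r')"
  unfolding dist_sq using assms
  by (simp add: lorentz_def divide_simps algebra_simps power2_eq_square)

lemma lorentz_Disc_Exterior:
  "lorentz (Disc c r) (Exterior c' r') = - lorentz (Disc c r) (Disc c' r')"
  by (simp add: lorentz_def diff_divide_distrib add_divide_distrib minus_divide_left[symmetric])

lemma lorentz_Disc_Halfplane:
  assumes "r > 0" "n \<bullet> c = h - r"
  shows "lorentz (Disc c r) (Halfplane n h) = - 1"
  using assms by (simp add: lorentz_def field_simps inner_commute[of c n])

section \<open>Tangency with disjoint interiors as a Lorentz product\<close>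

lemma dist_disjnt_balls:
  fixes c c' :: "'a :: euclidean_space"
  assumes "r > 0" "r' > 0" "disjnt (ball c r) (ball c' r')"
  shows "dist c c' \<ge> r + r'"
proof (rule ccontr)
  assume d: "\<not> dist c c' \<ge> r + r'"
  \<comment> \<open>The point dividing the segment of centres in the ratio \<open>r : r'\<close>
    lies in both balls when the centres are too close.\<close>
  define z where "z = c + (r / (r + r')) *\<^sub>R (c' - c)"
  have "dist c z = r / (r + r') * dist c c'"
    using assms by (simp add: z_def dist_norm norm_minus_commute)
  moreover have "r' / (r + r') = 1 - r / (r + r')"
    using assms by (simp add: field_simps)
  then have "c' - z = (r' / (r + r')) *\<^sub>R (c' - c)"
    by (simp only: z_def scaleR_left_diff_distrib) (simp add: algebra_simps)
  then have "dist c' z = r' / (r + r') * dist c c'"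
    using assms by (simp add: dist_norm norm_minus_commute)
  moreover have "x / (r + r') * dist c c' < x" if "x > 0" for x
  proof -
    have "x * dist c c' < x * (r + r')" using d that by simp
    then show ?thesis using assms by (simp add: field_simps)
  qed
  ultimately have "z \<in> ball c r \<inter> ball c' r'" using assms by simp
  with assms(3) show False by (auto simp: disjnt_def)
qed

lemma halfplane_ball_disjnt:
  fixes n c :: "'a :: real_inner"
  assumes "norm n = 1" "r > 0" "disjnt (ball c r) {z. n \<bullet> z > h}"
  shows "n \<bullet> c + r \<le> h"
proof (rule field_le_epsilon)
  fix e :: real assume "e > 0"
  \<comment> \<open>The ball is open, so the centre can be pushed along \<open>n\<close> only by
    less than \<open>r\<close>; hence the detour through \<open>e\<close>. The \<open>max 0\<close>
    covers the case \<open>e > r\<close>.\<close>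
  define t where "t = max 0 (r - e)"
  have t: "0 \<le> t" "t < r" "r - e \<le> t" using \<open>e > 0\<close> assms by (auto simp: t_def)
  have "c + t *\<^sub>R n \<in> ball c r" using t assms by (simp add: dist_norm)
  with assms(3) have "n \<bullet> (c + t *\<^sub>R n) \<le> h" unfolding disjnt_iff mem_Collect_eq by (meson not_less)
  then have "n \<bullet> c + t \<le> h" using assms(1) by (simp add: inner_add_right dot_square_norm)
  with t show "n \<bullet> c + r \<le> h + e" by linarith
qed

text \<open>A common point bounds the distance on one side and disjointness bounds it on the other.
  Together they force \<open>dist c c' = r + r'\<close> for a disc,
  \<open>dist c c' = r' - r\<close> for an exterior and \<open>n \<bullet> c = h - r\<close> for a
  half-plane.\<close>

lemma lorentz_tangent_Disc:
  assumes p: "proper (Disc c r)" "proper C"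
    and t: "tangent (Disc c r) C" and d: "disjnt (ball c r) (circle_interior C)"
  shows "lorentz (Disc c r) C = - 1"
proof -
  have r: "r > 0" using p by simp
  obtain z where z: "z \<in> locus (Disc c r)" "z \<in> locus C" using t by (auto simp: tangent_def)
  then obtain w where w: "z = Some w" "dist c w = r" by auto
  show ?thesis
  proof (cases C)
    case (Disc c' r')
    with z w have "dist c' w = r'" by auto
    then have "dist c c' \<le> r + r'" using w by metric
    moreover have "dist c c' \<ge> r + r'" using dist_disjnt_balls[of r r' c c'] p d Disc by auto
    ultimately have "dist c c' = r + r'" by simp
    then show ?thesis using lorentz_Disc_Disc[of r r' c c'] p Disc
      by (simp add: field_simps power2_eq_square)
  next
    case (Exterior c' r')
    with z w have "dist c' w = r'" by auto
    then have "r' \<le> dist c c' + r" using w by metric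
    moreover have "ball c r \<subseteq> cball c' r'" using d Exterior by (auto simp: disjnt_iff)
    then have "dist c c' + r \<le> r'" using r by (simp add: ball_subset_cball_iff)
    ultimately have "dist c c' = r' - r" by simp
    then have "lorentz (Disc c r) (Disc c' r') = (r\<^sup>2 + r'\<^sup>2 - (r' - r)\<^sup>2) / (2 * r * r')"
      using lorentz_Disc_Disc[of r r' c c'] p Exterior by simp
    also have "\<dots> = 1" using p Exterior by (simp add: field_simps power2_eq_square)
    finally show ?thesis by (simp add: Exterior lorentz_Disc_Exterior)
  next
    case (Halfplane n h)
    with z w have "n \<bullet> w = h" by auto
    moreover have n: "norm n = 1" using p Halfplane by simp
    have "\<bar>n \<bullet> (w - c)\<bar> \<le> norm n * norm (w - c)" by (rule Cauchy_Schwarz_ineq2)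
    then have "n \<bullet> w - n \<bullet> c \<le> r"
      using n w by (simp add: inner_diff_right dist_norm norm_minus_commute)
    moreover have "n \<bullet> c + r \<le> h"
      using halfplane_ball_disjnt[OF n r] d Halfplane by simp
    ultimately show ?thesis using lorentz_Disc_Halfplane[OF r, of n c h] Halfplane by simp
  qed
qed

text \<open>Lines that are not parallel meet at a finite point as well as at infinity, against
  uniqueness, and half-planes with equal normals overlap. Only opposite normals remain.\<close>

lemma lorentz_tangent_Halfplane:
  assumes n: "norm n = 1" "norm n' = 1"
    and t: "tangent (Halfplane n h) (Halfplane n' h')"
    and d: "disjnt {z. n \<bullet> z > h} {z. n' \<bullet> z > h'}"
  shows "lorentz (Halfplane n h) (Halfplane n' h') = - 1"
proof -
  define g where "g = n \<bullet> n'"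
  have nn: "n \<bullet> n = 1" "n' \<bullet> n' = 1" "n' \<bullet> n = g"
    using n by (simp_all add: dot_square_norm g_def inner_commute)
  have "g\<^sup>2 = 1"
  proof (rule ccontr)
    assume g: "g\<^sup>2 \<noteq> 1"
    \<comment> \<open>Cramer's rule for \<open>n \<bullet> w = h\<close>,
      \<open>n' \<bullet> w = h'\<close> with \<open>w\<close> in the span of the normals.\<close>
    define w where "w = ((h - g * h') / (1 - g\<^sup>2)) *\<^sub>R n + ((h' - g * h) / (1 - g\<^sup>2)) *\<^sub>R n'"
    have "n \<bullet> w = h" "n' \<bullet> w = h'"
      using g unfolding w_def by (simp_all add: inner_add_right nn g_def[symmetric] divide_simps)
        (simp_all add: power2_eq_square algebra_simps)
    then have "Some w \<in> locus (Halfplane n h) \<inter> locus (Halfplane n' h')" by simp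
    moreover have "None \<in> locus (Halfplane n h) \<inter> locus (Halfplane n' h')" by simp
    ultimately show False using t unfolding tangent_def by blast
  qed
  moreover have "g \<noteq> 1"
  proof
    assume "g = 1"
    then have "(n - n') \<bullet> (n - n') = 0" by (simp add: inner_diff nn g_def[symmetric])
    then have "n = n'" by simp
    have "n \<bullet> ((\<bar>h\<bar> + \<bar>h'\<bar> + 1) *\<^sub>R n) = \<bar>h\<bar> + \<bar>h'\<bar> + 1" by (simp add: nn)
    then have "n \<bullet> ((\<bar>h\<bar> + \<bar>h'\<bar> + 1) *\<^sub>R n) > h" "n' \<bullet> ((\<bar>h\<bar> + \<bar>h'\<bar> + 1) *\<^sub>R n) > h'"
      unfolding \<open>n = n'\<close>[symmetric] by linarith+
    with d show False unfolding disjnt_iff mem_Collect_eq by meson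
  qed
  ultimately have "g = - 1" by (simp add: power2_eq_1_iff)
  then show ?thesis by (simp add: lorentz_def g_def)
qed

text \<open>A point far enough out, along \<open>n\<close> for a half-plane, lies in both interiors.
  So an exterior can only be paired with a disc, and a pair without discs consists of two
  half-planes.\<close>

lemma interior_meets_Exterior:
  assumes "\<And>c r. C \<noteq> Disc c r" "proper C"
  shows "\<not> disjnt (circle_interior C) (circle_interior (Exterior c' r'))"
proof (cases C)
  case (Exterior c r)
  define z :: complex where "z = of_real (norm c + norm c' + \<bar>r\<bar> + \<bar>r'\<bar> + 1)"
  have "norm z = norm c + norm c' + \<bar>r\<bar> + \<bar>r'\<bar> + 1" unfolding z_def norm_of_real by simp
  moreover have "dist c z \<ge> norm z - norm c" "dist c' z \<ge> norm z - norm c'"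
    using norm_triangle_ineq2[of z c] norm_triangle_ineq2[of z c']
    by (simp_all add: dist_norm norm_minus_commute)
  ultimately have "dist c z > r" "dist c' z > r'"
    using norm_ge_zero[of c] norm_ge_zero[of c'] by linarith+
  then show ?thesis using Exterior by (auto simp: disjnt_iff not_le)
next
  case (Halfplane n h)
  then have n: "norm n = 1" using assms by simp
  define z where "z = (norm c' + \<bar>r'\<bar> + \<bar>h\<bar> + 1) *\<^sub>R n"
  have "norm z = norm c' + \<bar>r'\<bar> + \<bar>h\<bar> + 1" unfolding z_def using n by simp
  moreover have "n \<bullet> z = norm c' + \<bar>r'\<bar> + \<bar>h\<bar> + 1"
    unfolding z_def using n by (simp add: dot_square_norm)
  moreover have "dist c' z \<ge> norm z - norm c'"
    using norm_triangle_ineq2[of z c'] by (simp add: dist_norm norm_minus_commute)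
  ultimately have "n \<bullet> z > h" "dist c' z > r'"
    using norm_ge_zero[of c'] by linarith+
  then show ?thesis using Halfplane by (auto simp: disjnt_iff not_le)
qed (use assms in blast)

lemma tangent_commute: "tangent C C' \<longleftrightarrow> tangent C' C"
  by (simp add: tangent_def Int_commute)

lemma lorentz_tangent:
  assumes p: "proper C" "proper C'" and t: "tangent C C'"
    and d: "disjnt (circle_interior C) (circle_interior C')"
  shows "lorentz C C' = - 1"
proof -
  consider c r where "C = Disc c r" | c r where "C' = Disc c r"
    | "\<And>c r. C \<noteq> Disc c r" "\<And>c r. C' \<noteq> Disc c r" by blast
  then show ?thesis
  proof cases
    case 1 then show ?thesis using lorentz_tangent_Disc p t d by simp
  next
    case 2
    then have "lorentz C' C = - 1"
      using lorentz_tangent_Disc[of c r C] p t d tangent_commute disjnt_sym by auto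
    then show ?thesis by (simp add: lorentz_commute)
  next
    case 3
    have "\<And>c r. C \<noteq> Exterior c r" "\<And>c r. C' \<noteq> Exterior c r"
      using interior_meets_Exterior 3 p d disjnt_sym by metis+
    with 3 obtain n h n' h' where "C = Halfplane n h" "C' = Halfplane n' h'"
      by (metis gcircle.exhaust)
    then show ?thesis using lorentz_tangent_Halfplane p t d by simp
  qed
qed

text \<open>
  The Gram matrix of the four circles is \<open>G = 2 I - J\<close>, so \<open>W Q W\<^sup>T = G\<close> for the matrix \<open>W\<close>
  of their coordinates and the matrix \<open>Q\<close> of the form.  As \<open>G\<^sup>2 = 4 I\<close>, inverting gives
  \<open>W\<^sup>T G W = 4 Q\<^sup>-\<^sup>1\<close>, whose entry for the curvatures is \<open>0\<close>.
\<close>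

lemma descartes_equation_of_gram:
  fixes x y k l :: "4 \<Rightarrow> real"
  assumes gram: "\<And>i j. x i * x j + y i * y j - (k i * l j + l i * k j) / 2 = (if i = j then 1 else - 1)"
  shows "2 * (\<Sum>i\<in>UNIV. (k i)\<^sup>2) = (\<Sum>i\<in>UNIV. k i)\<^sup>2"
proof -
  define W :: "real^4^4" where "W = (\<chi> i j. if j = 1 then x i else if j = 2 then y i else if j = 3 then k i else l i)"
  \<comment> \<open>\<open>V\<close> is Q W^T G / 4, the candidate right inverse of
    \<open>W\<close>: Q W^T has the rows \<open>x\<close>, \<open>y\<close>, \<open>- l / 2\<close>,
    \<open>- k / 2\<close>.\<close>
  define V :: "real^4^4" where "V = (\<chi> i j. \<Sum>m\<in>UNIV. (if m = j then 1 else - 1) / 4 *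
     (if i = 1 then x m else if i = 2 then y m else if i = 3 then - l m / 2 else - k m / 2))"
  have "(W ** V) $ i $ j = (mat 1 :: real^4^4) $ i $ j" for i j
  proof -
    have "(W ** V) $ i $ j = (\<Sum>a\<in>UNIV. W $ i $ a * V $ a $ j)"
      by (simp add: matrix_matrix_mult_def)
    also have "\<dots> = (\<Sum>m\<in>UNIV. (if m = j then 1 else - 1) / 4 *
      (x i * x m + y i * y m - (k i * l m + l i * k m) / 2))"
      unfolding sum_4[of "\<lambda>a. W $ i $ a * V $ a $ j"]
      by (simp add: W_def V_def sum_distrib_left flip: sum.distrib)
        (rule sum.cong, simp, simp add: field_simps)
    also have "\<dots> = (\<Sum>m\<in>UNIV. (if m = j then 1 else - 1) / 4 * (if i = m then 1 else - 1))"
      unfolding gram ..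
    also have "\<dots> = (if i = j then 1 else 0)"
      using exhaust_4[of i] exhaust_4[of j] by (elim disjE) (simp_all add: sum_4)
    finally show ?thesis by (simp add: mat_def)
  qed
  then have "W ** V = mat 1" by (simp add: vec_eq_iff)
  then have "V ** W = mat 1" using matrix_left_right_inverse by blast
  \<comment> \<open>This off-diagonal entry is - (k^T G k) / 8, and k^T G k is the difference of the
    two sides of the Descartes equation.\<close>
  then have "(V ** W) $ 4 $ 3 = (mat 1 :: real^4^4) $ 4 $ 3" by simp
  then show ?thesis
    unfolding V_def W_def
    by (simp add: matrix_matrix_mult_def mat_def sum_4 power2_eq_square field_simps)
qed

theorem descartes_circle_theorem:
  assumes "descartes_configuration D"
  shows "2 * (\<Sum>C\<in>D. (curvature C)\<^sup>2) = (\<Sum>C\<in>D. curvature C)\<^sup>2"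
proof -
  have D: "card D = 4" "\<And>C. C \<in> D \<Longrightarrow> proper C"
    "\<And>C C'. C \<in> D \<Longrightarrow> C' \<in> D \<Longrightarrow> C \<noteq> C' \<Longrightarrow> tangent C C'"
    "\<And>C C'. C \<in> D \<Longrightarrow> C' \<in> D \<Longrightarrow> C \<noteq> C' \<Longrightarrow> disjnt (circle_interior C) (circle_interior C')"
    using assms unfolding descartes_configuration_def pairwise_def by blast+
  have "finite D" using D(1) by (simp add: card_ge_0_finite)
  then obtain f :: "4 \<Rightarrow> gcircle" where f: "bij_betw f UNIV D"
    using finite_same_card_bij[of "UNIV :: 4 set" D] D(1) by auto
  have fD: "f i \<in> D" for i using f by (auto simp: bij_betw_def)
  have "lorentz (f i) (f j) = (if i = j then 1 else - 1)" for i j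
  proof (cases "i = j")
    case False
    then have "f i \<noteq> f j" using f by (auto simp: bij_betw_def inj_on_def)
    then show ?thesis using False D(2-4) fD lorentz_tangent by simp
  qed (simp add: lorentz_self D(2) fD)
  then have "2 * (\<Sum>i\<in>UNIV. (curvature (f i))\<^sup>2) = (\<Sum>i\<in>UNIV. curvature (f i))\<^sup>2"
    by (intro descartes_equation_of_gram[of "\<lambda>i. Re (curv_centre (f i))" "\<lambda>i. Im (curv_centre (f i))"
          _ "\<lambda>i. co_curvature (f i)"]) (simp add: lorentz_def inner_complex_def)
  then show ?thesis
    using sum.reindex_bij_betw[OF f, of "\<lambda>C. (curvature C)\<^sup>2"] sum.reindex_bij_betw[OF f, of curvature] by simp
qed

section \<open>Primitive Descartes quadruples modulo 3 and 4\<close>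

text \<open>- 1 is not a square modulo \<open>p\<close>: as (p - 1) / 2 is odd, raising x^2 = - y^2
  to this power and applying Fermat's theorem would give 1 = - 1 modulo \<open>p\<close>.\<close>

lemma prime_dvd_sum_squares_3_mod_4:
  fixes a b :: int and p :: nat
  assumes p: "prime p" "p mod 4 = 3" and dvd: "int p dvd a\<^sup>2 + b\<^sup>2"
  shows "int p dvd a" "int p dvd b"
proof -
  have *: "int p dvd y" if d: "int p dvd x\<^sup>2 + y\<^sup>2" for x y :: int
  proof (rule ccontr)
    assume ny: "\<not> int p dvd y"
    have "\<not> int p dvd x"
    proof
      assume "int p dvd x"
      then have "int p dvd x\<^sup>2" by (simp add: power2_eq_square)
      with d have "int p dvd y\<^sup>2" using dvd_add_right_iff by blast
      with p ny show False by (simp add: prime_dvd_power_iff)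
    qed
    obtain m where m: "p - 1 = 2 * m" "odd m"
    proof
      show "p - 1 = 2 * (2 * (p div 4) + 1)"
        using p(2) by presburger
    qed simp
    have f: "[z ^ (p - 1) = 1] (mod int p)" if "\<not> int p dvd z" for z
    proof -
      have "[nat \<bar>z\<bar> ^ (p - 1) = 1] (mod p)"
        using p(1) that by (intro fermat_theorem) (simp_all add: nat_abs_dvd_iff nat_dvd_iff flip: int_dvd_int_iff)
      then have "[\<bar>z\<bar> ^ (p - 1) = 1] (mod int p)"
        by (simp flip: cong_int_iff)
      then show ?thesis
        using m(1) by (simp add: power_mult)
    qed
    have "[x\<^sup>2 = - (y\<^sup>2)] (mod int p)" using d by (simp add: cong_iff_dvd_diff)
    then have "[(x\<^sup>2) ^ m = (- (y\<^sup>2)) ^ m] (mod int p)" by (rule cong_pow)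
    then have "[x ^ (p - 1) = - (y ^ (p - 1))] (mod int p)"
      using m by (simp add: power_mult)
    with f[OF ny] f[OF \<open>\<not> int p dvd x\<close>] have "[1 = - 1] (mod int p)"
      by (meson cong_minus_minus_iff cong_sym cong_trans)
    then have "int p dvd 2" by (simp add: cong_iff_dvd_diff)
    then have "p \<le> 2" using zdvd_imp_le[of "int p" 2] by simp
    with p show False by (cases "p = 0 \<or> p = 1 \<or> p = 2") auto
  qed
  from *[OF dvd] show "int p dvd b" .
  from *[of b a] dvd show "int p dvd a" by (simp add: add.commute)
qed

text \<open>A product that is 3 modulo 4 has a factor that is 3 modulo 4, so either the split-off
  prime serves or the induction continues with the cofactor.\<close>

lemma ex_prime_factor_3_mod_4:
  fixes n :: nat
  assumes "n mod 4 = 3"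
  obtains p where "prime p" "p mod 4 = 3" "p dvd n"
proof -
  have "\<exists>p. prime p \<and> p mod 4 = 3 \<and> p dvd n" using assms
  proof (induction n rule: less_induct)
    case (less n)
    then have "n \<noteq> 1" by auto
    then obtain p where p: "prime p" "p dvd n" by (meson prime_factor_nat)
    then obtain m where m: "n = p * m" by blast
    have "p mod 4 * (m mod 4) mod 4 = 3"
      using less.prems unfolding m by (simp add: mod_mult_eq)
    moreover have "p mod 4 \<in> {0, 1, 2, 3}" "m mod 4 \<in> {0, 1, 2, 3}" by auto
    ultimately have "p mod 4 = 3 \<or> m mod 4 = 3"
      by (elim insertE emptyE) simp_all
    then show ?case
    proof
      assume "m mod 4 = 3"
      moreover have "m < n" using m p(1) less.prems prime_gt_1_nat[of p] by (cases "m = 0") auto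
      ultimately show ?thesis using less.IH m by (metis dvd_mult)
    qed (use p in auto)
  qed
  with that show ?thesis by blast
qed

text \<open>
  A prime \<open>p \<equiv> 3\<close> modulo 4 dividing \<open>x\<close> divides \<open>a\<close> and \<open>m\<close>, hence not \<open>y\<close>, so it can be
  cancelled from \<open>x/p\<^sup>2\<close>, \<open>a/p\<close>, \<open>m/p\<close>.
\<close>

lemma factor_of_sum_squares_not_3_mod_4:
  fixes x y a m :: int
  assumes "x \<ge> 0" "x * y = a\<^sup>2 + m\<^sup>2"
    and "\<And>p. prime p \<Longrightarrow> \<not> (p dvd x \<and> p dvd y \<and> p dvd a \<and> p dvd m)"
  shows "x mod 4 \<noteq> 3"
  using assms
proof (induction "nat x" arbitrary: x a m rule: less_induct)
  case less
  show ?case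
  proof
    assume x: "x mod 4 = 3"
    then have "nat x mod 4 = 3" using less.prems(1) by (metis nat_mod_distrib nat_numeral zero_le_numeral)
    then obtain p where p: "prime p" "p mod 4 = 3" "p dvd nat x"
      by (rule ex_prime_factor_3_mod_4)
    have px: "int p dvd x" using p(3) less.prems(1) by (metis int_dvd_int_iff nat_0_le)
    then have "int p dvd a\<^sup>2 + m\<^sup>2" using less.prems(2) by (metis dvd_mult2)
    note pam = prime_dvd_sum_squares_3_mod_4[OF p(1,2) this]
    then obtain a' m' where a': "a = int p * a'" and m': "m = int p * m'" by blast
    have ip: "prime (int p)" using p by simp
    have "\<not> int p dvd y" using less.prems(3)[OF ip] px pam by blast
    have p0: "int p > 0" using p(1) prime_gt_0_nat by simp
    obtain x1 where x1: "x = int p * x1" using px by blast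
    have "int p * (x1 * y) = int p * (int p * (a'\<^sup>2 + m'\<^sup>2))"
      using less.prems(2) unfolding x1 a' m' by (simp add: power2_eq_square algebra_simps)
    then have e: "x1 * y = int p * (a'\<^sup>2 + m'\<^sup>2)" using p0 by simp
    then have "int p dvd x1 * y" by simp
    with \<open>\<not> int p dvd y\<close> ip have "int p dvd x1" using prime_dvd_mult_iff by blast
    then obtain x' where x': "x1 = int p * x'" by blast
    from e p0 have e': "x' * y = a'\<^sup>2 + m'\<^sup>2" unfolding x' by (simp add: mult.assoc)
    have xx: "x = (int p)\<^sup>2 * x'" using x1 x' by (simp add: power2_eq_square)
    have "x \<noteq> 0" using x by auto
    then have xpos: "x > 0" using less.prems(1) by simp
    have x'pos: "x' > 0" using xpos p0 unfolding xx by (simp add: zero_less_mult_iff)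
    have "(int p)\<^sup>2 > 1" using p(1) prime_gt_1_nat[of p] by (simp add: one_less_power)
    then have "x' < x" using x'pos unfolding xx by simp
    then have lt: "nat x' < nat x" using x'pos by simp
    have "x' mod 4 \<noteq> 3"
    proof (rule less.hyps[OF lt _ e'])
      show "\<not> (q dvd x' \<and> q dvd y \<and> q dvd a' \<and> q dvd m')" if "prime q" for q
        using less.prems(3)[OF that] unfolding xx a' m' by auto
    qed (use x'pos in simp)
    \<comment> \<open>Dividing by p^2 keeps the residue modulo 4, so the descent from
      \<open>x\<close> to \<open>x'\<close> carries the claim back.\<close>
    moreover have "(int p)\<^sup>2 mod 4 = 1"
    proof -
      have "int p mod 4 = 3" using p(2) by (metis of_nat_mod of_nat_numeral)
      then have "(int p)\<^sup>2 mod 4 = 3\<^sup>2 mod 4" by (metis power_mod)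
      then show ?thesis by simp
    qed
    then have "x mod 4 = x' mod 4" unfolding xx by (metis mod_mult_left_eq mult_1)
    ultimately show False using x by simp
  qed
qed

section \<open>Residues of primitive Descartes quadruples\<close>

definition descartes_primitive :: "int multiset \<Rightarrow> bool" where
  "descartes_primitive q \<longleftrightarrow> size q = 4 \<and> 2 * (\<Sum>x\<in>#q. x\<^sup>2) = (sum_mset q)\<^sup>2 \<and>
     sum_mset q > 0 \<and> Gcd (set_mset q) = 1"

text \<open>Two pair sums with a common entry have a product that is a sum of squares up to the
  factor 4, so they never have opposite signs. If \<open>a + b\<close> were negative,
  \<open>a + c\<close> and \<open>b + d\<close> would both be at most 0, but they add up to the
  positive total.\<close>

lemma descartes_pair_nonneg:
  fixes a b c d :: int
  assumes eq: "2 * (a\<^sup>2 + b\<^sup>2 + c\<^sup>2 + d\<^sup>2) = (a + b + c + d)\<^sup>2" and pos: "a + b + c + d > 0"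
  shows "a + b \<ge> 0"
proof (rule ccontr)
  have *: "(x + y) * (x + z) \<ge> 0"
    if "2 * (x\<^sup>2 + y\<^sup>2 + z\<^sup>2 + w\<^sup>2) = (x + y + z + w)\<^sup>2" for x y z w :: int
  proof -
    have "4 * ((x + y) * (x + z)) = 4 * x\<^sup>2 + (x + y + z - w)\<^sup>2"
      using that by (simp add: power2_eq_square algebra_simps)
    moreover have "4 * x\<^sup>2 + (x + y + z - w)\<^sup>2 \<ge> 0" by simp
    ultimately show ?thesis by linarith
  qed
  assume neg: "\<not> a + b \<ge> 0"
  have "(a + b) * (a + c) \<ge> 0" "(a + b) * (a + d) \<ge> 0" "(b + a) * (b + c) \<ge> 0"
    "(b + a) * (b + d) \<ge> 0" "(c + d) * (c + a) \<ge> 0" "(d + c) * (d + b) \<ge> 0"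
    using *[of a b c d] *[of a b d c] *[of b a c d] *[of b a d c] *[of c d a b] *[of d c b a] eq
    by (simp_all add: ac_simps)
  with neg pos show False
    by (auto simp: zero_le_mult_iff)
qed

lemma descartes_pair_not_3_mod_4:
  fixes a b c d :: int
  assumes eq: "2 * (a\<^sup>2 + b\<^sup>2 + c\<^sup>2 + d\<^sup>2) = (a + b + c + d)\<^sup>2" and pos: "a + b + c + d > 0"
    and prim: "Gcd {a, b, c, d} = 1"
  shows "(a + b) mod 4 \<noteq> 3"
proof -
  have "even ((a + b + c + d)\<^sup>2)" using eq by (metis dvd_triv_left)
  then have "even (a + b + c - d)" by simp
  then obtain m where m: "a + b + c - d = 2 * m" by blast
  then have d: "d = a + b + c - 2 * m" by simp
  have "(a + b) * (a + c) = a\<^sup>2 + m\<^sup>2"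
    using eq unfolding d by (simp add: power2_eq_square algebra_simps)
  then show ?thesis
  proof (rule factor_of_sum_squares_not_3_mod_4[OF descartes_pair_nonneg[OF eq pos]])
    \<comment> \<open>Since \<open>d = a + b + c - 2 * m\<close>, such a prime would divide all four
      entries.\<close>
    fix p :: int assume "prime p"
    show "\<not> (p dvd a + b \<and> p dvd a + c \<and> p dvd a \<and> p dvd m)"
    proof
      assume p: "p dvd a + b \<and> p dvd a + c \<and> p dvd a \<and> p dvd m"
      then have "p dvd b" "p dvd c" using dvd_add_right_iff by blast+
      with p have "p dvd Gcd {a, b, c, d}" unfolding d by (auto intro!: Gcd_greatest)
      with prim \<open>prime p\<close> show False by auto
    qed
  qed
qed

text \<open>The sum is even, so with one odd entry there are two or four. Four odd entries would
  make a square congruent to 2 modulo 4, because x^2 + x is always even.\<close>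

lemma two_odd_of_four:
  fixes a b c d :: int
  assumes eq: "2 * (a\<^sup>2 + b\<^sup>2 + c\<^sup>2 + d\<^sup>2) = (a + b + c + d)\<^sup>2" and odd: "odd a"
  shows "(odd b \<and> even c \<and> even d) \<or> (even b \<and> odd c \<and> even d) \<or> (even b \<and> even c \<and> odd d)"
proof -
  have "even ((a + b + c + d)\<^sup>2)" using eq by (metis dvd_triv_left)
  then have ev: "even (a + b + c + d)" by simp
  have "\<not> (odd b \<and> odd c \<and> odd d)"
  proof
    assume o: "odd b \<and> odd c \<and> odd d"
    obtain a' b' c' d' where "a = 2 * a' + 1" "b = 2 * b' + 1" "c = 2 * c' + 1" "d = 2 * d' + 1"
      using odd o by (meson oddE)
    note s = this
    have "(a'\<^sup>2 + a') * 2 + (b'\<^sup>2 + b') * 2 + (c'\<^sup>2 + c') * 2 + (d'\<^sup>2 + d') * 2 + 2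
      = (a' + b' + c' + d' + 2)\<^sup>2"
      using eq unfolding s by (simp add: power2_eq_square algebra_simps)
    moreover have "\<exists>k. (x\<^sup>2 + x) * 2 = 4 * k" for x :: int
    proof -
      have "even (x\<^sup>2 + x)" by simp
      then obtain k where "x\<^sup>2 + x = 2 * k" by blast
      then show ?thesis by (intro exI[of _ k]) simp
    qed
    ultimately obtain k where m: "(a' + b' + c' + d' + 2)\<^sup>2 = 4 * k + 2"
      by (metis distrib_left)
    then have "even ((a' + b' + c' + d' + 2)\<^sup>2)" by simp
    then obtain t where "a' + b' + c' + d' + 2 = 2 * t" by (metis evenE even_power)
    with m have "2 * (t * t - k) * 2 = 2" by (simp add: power2_eq_square)
    then show False by presburger
  qed
  with ev odd show ?thesis by auto
qed

lemma descartes_primitive_split: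
  assumes "descartes_primitive q"
  obtains a b c d where "q = {#a, b, c, d#}" "even a" "even b" "odd c" "odd d"
proof -
  have "size q = 4" using assms by (simp add: descartes_primitive_def)
  have "\<exists>x\<in>#q. odd x"
  proof (rule ccontr)
    assume "\<not> (\<exists>x\<in>#q. odd x)"
    then have "2 dvd Gcd (set_mset q)" by (auto intro: Gcd_greatest)
    with assms show False by (simp add: descartes_primitive_def)
  qed
  then obtain a r where r: "odd a" "q = add_mset a r" by (metis multi_member_split)
  obtain rs where rs: "r = mset rs" by (metis ex_mset)
  with \<open>size q = 4\<close> r(2) have "length rs = 3" by simp
  then obtain b c d where "rs = [b, c, d]" by (auto simp: numeral_eq_Suc length_Suc_conv)
  then have q: "q = {#a, b, c, d#}" using r(2) rs by simp
  have "2 * (a\<^sup>2 + b\<^sup>2 + c\<^sup>2 + d\<^sup>2) = (a + b + c + d)\<^sup>2"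
    using assms unfolding descartes_primitive_def q by (simp add: algebra_simps)
  from two_odd_of_four[OF this r(1)] show thesis
    using that[of c d a b] that[of b d a c] that[of b c a d] r(1) unfolding q
    by (auto simp: add_mset_commute)
qed

text \<open>The equation for the halved entries makes \<open>a' + b'\<close> and
  \<open>c' + d'\<close> even. The condition on \<open>a + c\<close> then selects c = a + 1 over c =
  a - 1 modulo 4.\<close>

lemma descartes_mod_4:
  fixes a b c d :: int
  assumes eq: "2 * (a\<^sup>2 + b\<^sup>2 + c\<^sup>2 + d\<^sup>2) = (a + b + c + d)\<^sup>2"
    and "even a" "even b" "odd c" "odd d" "(a + c) mod 4 \<noteq> 3"
  shows "a mod 4 = b mod 4" "c mod 4 = d mod 4" "c mod 4 = a mod 4 + 1"
proof -
  obtain a' b' c' d' where s: "a = 2 * a'" "b = 2 * b'" "c = 2 * c' + 1" "d = 2 * d' + 1"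
    using assms by (meson oddE evenE)
  define t where "t = a' + b' + c' + d' + 1"
  have e: "2 * (a'\<^sup>2 + b'\<^sup>2 + (c'\<^sup>2 + c') + (d'\<^sup>2 + d')) + 1 = t\<^sup>2"
    using eq unfolding s t_def by (simp add: power2_eq_square algebra_simps)
  then have "odd (t\<^sup>2)" by (metis dvd_triv_left even_plus_one_iff)
  then have "odd t" by simp
  then obtain t' where t': "t = 2 * t' + 1" by (rule oddE)
  have "a'\<^sup>2 + b'\<^sup>2 + (c'\<^sup>2 + c') + (d'\<^sup>2 + d') = 2 * (t'\<^sup>2 + t')"
    using e unfolding t' by (simp add: power2_eq_square algebra_simps)
  moreover have "even (x\<^sup>2 + x)" for x :: int by simp
  ultimately have "even (a'\<^sup>2 + b'\<^sup>2)"
    by (metis dvd_add_left_iff dvd_triv_left)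
  then have p: "even (a' + b')" by simp
  moreover have "even (c' + d')" using p \<open>odd t\<close> unfolding t_def by presburger
  ultimately show "a mod 4 = b mod 4" "c mod 4 = d mod 4" "c mod 4 = a mod 4 + 1"
    using assms(6) unfolding s by presburger+
qed

text \<open>A finite check: up to a common sign \<open>e\<close> all residues are 0 or 1, and the
  sum counts the nonzero ones. This count and the parities are what characterise
  \<open>Y\<close>.\<close>

lemma descartes_mod_3:
  fixes a b c d :: int
  assumes eq: "2 * (a\<^sup>2 + b\<^sup>2 + c\<^sup>2 + d\<^sup>2) = (a + b + c + d)\<^sup>2" and prim: "Gcd {a, b, c, d} = 1"
  shows "\<exists>e\<in>{1, - 1}. (\<forall>x\<in>{a, b, c, d}. (e * x) mod 3 \<in> {0, 1}) \<and>
    (e * a) mod 3 + (e * b) mod 3 + (e * c) mod 3 + (e * d) mod 3 \<in> {2, 3}"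
proof -
  define u v w z where r: "u = a mod 3" "v = b mod 3" "w = c mod 3" "z = d mod 3"
  have m: "[2 * (u\<^sup>2 + v\<^sup>2 + w\<^sup>2 + z\<^sup>2) = (u + v + w + z)\<^sup>2] (mod 3)"
  proof -
    have "[2 * (u\<^sup>2 + v\<^sup>2 + w\<^sup>2 + z\<^sup>2) = 2 * (a\<^sup>2 + b\<^sup>2 + c\<^sup>2 + d\<^sup>2)] (mod 3)"
      "[(a + b + c + d)\<^sup>2 = (u + v + w + z)\<^sup>2] (mod 3)"
      by (intro cong_mult cong_add cong_pow cong_refl; simp add: r cong_def)+
    with eq show ?thesis by (metis cong_trans)
  qed
  have n: "\<not> (u = 0 \<and> v = 0 \<and> w = 0 \<and> z = 0)"
  proof
    assume "u = 0 \<and> v = 0 \<and> w = 0 \<and> z = 0"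
    then have "3 dvd Gcd {a, b, c, d}" by (auto intro!: Gcd_greatest simp: r)
    with prim show False by simp
  qed
  have "u \<in> {0,1,2}" "v \<in> {0,1,2}" "w \<in> {0,1,2}" "z \<in> {0,1,2}" unfolding r by auto
  then have "\<exists>e\<in>{1,- 1}. (\<forall>x\<in>{u,v,w,z}. (e * x) mod 3 \<in> {0, 1}) \<and>
    (e * u) mod 3 + (e * v) mod 3 + (e * w) mod 3 + (e * z) mod 3 \<in> {2, 3}"
    using m n by (elim insertE emptyE) (simp_all add: cong_def)
  then show ?thesis unfolding r by (simp add: mod_simps)
qed


section \<open>Orbits modulo 12\<close>

text \<open>With \<open>e\<close> equal to 1 or - 1 this covers \<open>const_plus\<close> and
  \<open>const_minus\<close> at once, so the four orbits can be treated uniformly.\<close>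

definition affine12 :: "int \<Rightarrow> int \<Rightarrow> int multiset \<Rightarrow> int multiset" where
  "affine12 k e q = mod12 (image_mset (\<lambda>y. k + e * y) q)"

lemma mod12_empty [simp]: "mod12 {#} = {#}"
  and mod12_add_mset [simp]: "mod12 (add_mset x q) = add_mset (x mod 12) (mod12 q)"
  and mod12_mod12 [simp]: "mod12 (mod12 q) = mod12 q"
  and size_mod12 [simp]: "size (mod12 q) = size q"
  by (simp_all add: mod12_def multiset.map_comp o_def)

lemma affine12_mod12: "affine12 k e (mod12 q) = affine12 k e q"
proof -
  have "(k + e * (x mod 12)) mod 12 = (k + e * x) mod 12" for x
    by (metis mod_add_right_eq mod_mult_right_eq)
  then show ?thesis unfolding affine12_def mod12_def by (simp add: multiset.map_comp o_def)
qed

lemma affine12_affine: "affine12 k e (affine12 k' e' q) = affine12 (k + e * k') (e * e') q"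
proof -
  have "affine12 k e (affine12 k' e' q) = affine12 k e (image_mset (\<lambda>y. k' + e' * y) q)"
    by (simp add: affine12_def[of k' e'] affine12_mod12)
  then show ?thesis by (simp add: affine12_def multiset.map_comp o_def algebra_simps)
qed

lemma affine12_0_1: "affine12 0 1 q = mod12 q"
  by (simp add: affine12_def)

lemma affine12_inverse:
  assumes "e \<in> {1, - 1}"
  shows "affine12 k e (affine12 (- (e * k)) e q) = mod12 q"
    and "affine12 (- (e * k)) e (affine12 k e q) = mod12 q"
  using assms by (auto simp: affine12_affine affine12_0_1)

lemma mod12_in_affine_image:
  assumes "e \<in> {1, - 1}" "affine12 (- (e * k)) e q \<in> A"
  shows "mod12 q \<in> affine12 k e ` A"
  using affine12_inverse(1)[OF assms(1), of k q] assms(2) by (metis imageI)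

lemma sum_mset_mod12: "sum_mset (mod12 q) mod 12 = sum_mset q mod 12"
proof (induction q)
  case (add x q)
  then have "(x mod 12 + sum_mset (mod12 q)) mod 12 = (x + sum_mset q) mod 12"
    by (intro mod_add_cong) simp_all
  then show ?case by simp
qed simp

lemma sum_mset_affine: "(\<Sum>y\<in>#q. k + e * y) = int (size q) * k + e * sum_mset q"
  by (induction q) (simp_all add: algebra_simps)

text \<open>Closure under all the generators, phrased for multisets: \<open>x\<close> is the
  replaced entry and \<open>r\<close> the other three. Orderings and coordinates do not
  enter.\<close>

definition swap_closed :: "int multiset set \<Rightarrow> bool" where
  "swap_closed A \<longleftrightarrow> (\<forall>x r. size r = 3 \<longrightarrow> mod12 (add_mset x r) \<in> A \<longrightarrow>
     mod12 (add_mset (2 * sum_mset r - x) r) \<in> A)"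

lemma swap_closedD:
  "swap_closed A \<Longrightarrow> mod12 (add_mset x r) \<in> A \<Longrightarrow> size r = 3 \<Longrightarrow> mod12 (add_mset (2 * sum_mset r - x) r) \<in> A"
  by (simp add: swap_closed_def)

lemma swap_mod12_cong:
  assumes "mod12 r = mod12 r'" "x mod 12 = x' mod 12"
  shows "mod12 (add_mset (2 * sum_mset r - x) r) = mod12 (add_mset (2 * sum_mset r' - x') r')"
proof -
  have "sum_mset r mod 12 = sum_mset r' mod 12" using assms(1) by (metis sum_mset_mod12)
  then have "(2 * sum_mset r - x) mod 12 = (2 * sum_mset r' - x') mod 12"
    using assms(2) by (intro mod_diff_cong mod_mult_cong) simp_all
  with assms(1) show ?thesis by simp
qed

lemma mod12_Y: "q \<in> Y \<Longrightarrow> mod12 q = q"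
  by (auto simp: Y_def)

lemma swap_closed_Y: "swap_closed Y"
  unfolding swap_closed_def
proof (intro allI impI)
  \<comment> \<open>The finite check on the reduced representatives; arbitrary integer lifts follow
    because the swap respects congruence.\<close>
  have *: "\<forall>q\<in>Y. \<forall>x\<in>#q. mod12 (add_mset (2 * sum_mset (q - {#x#}) - x) (q - {#x#})) \<in> Y"
    by (simp add: Y_def add_mset_commute)
  fix x r assume "mod12 (add_mset x r) \<in> Y"
  then have "mod12 (add_mset (2 * sum_mset (mod12 r) - x mod 12) (mod12 r)) \<in> Y"
    using *[rule_format, of "mod12 (add_mset x r)" "x mod 12"] by simp
  then show "mod12 (add_mset (2 * sum_mset r - x) r) \<in> Y"
    by (subst swap_mod12_cong[of r "mod12 r" x "x mod 12"]) simp_all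
qed

text \<open>Before reduction the two sides differ by \<open>4 k\<close>, which is \<open>0\<close> modulo \<open>12\<close>.\<close>

lemma affine12_swap:
  assumes "3 dvd k" "size r = 3"
  shows "affine12 k e (add_mset (2 * sum_mset r - x) r) =
    mod12 (add_mset (2 * (\<Sum>y\<in>#r. k + e * y) - (k + e * x)) (image_mset (\<lambda>y. k + e * y) r))"
proof -
  obtain j where "k = 3 * j" using assms(1) by blast
  then have eq: "2 * (\<Sum>y\<in>#r. k + e * y) - (k + e * x) = k + e * (2 * sum_mset r - x) + j * 12"
    by (simp only: sum_mset_affine assms(2)) (simp add: algebra_simps)
  show ?thesis
    by (simp only: affine12_def image_mset_add_mset mod12_add_mset eq mod_mult_self1)
qed

text \<open>Pull back by the inverse map, swap inside \<open>A\<close>, and push forward;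
  \<open>affine12_swap\<close> makes the swap commute with both maps.\<close>

lemma swap_closed_affine:
  assumes "swap_closed A" "\<And>q. q \<in> A \<Longrightarrow> mod12 q = q" "3 dvd k" "e \<in> {1, - 1}"
  shows "swap_closed (affine12 k e ` A)"
  unfolding swap_closed_def
proof (intro allI impI)
  fix x r assume r: "size r = 3" "mod12 (add_mset x r) \<in> affine12 k e ` A"
  then obtain q where q: "q \<in> A" "mod12 (add_mset x r) = affine12 k e q" by blast
  define k' where "k' = - (e * k)"
  have k': "3 dvd k'" using assms(3) by (simp add: k'_def)
  have "affine12 k' e (add_mset x r) = affine12 k' e (affine12 k e q)"
    using affine12_mod12[of k' e "add_mset x r"] by (simp only: q(2))
  also have "\<dots> = q"
    unfolding k'_def affine12_inverse(2)[OF assms(4)] by (rule assms(2)[OF q(1)])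
  finally have "mod12 (add_mset (k' + e * x) (image_mset (\<lambda>y. k' + e * y) r)) \<in> A"
    using q(1) by (simp add: affine12_def)
  from swap_closedD[OF assms(1) this] r(1) have "affine12 k' e (add_mset (2 * sum_mset r - x) r) \<in> A"
    unfolding affine12_swap[OF k' r(1)] by simp
  then show "mod12 (add_mset (2 * sum_mset r - x) r) \<in> affine12 k e ` A"
    unfolding k'_def by (rule mod12_in_affine_image[OF assms(4)])
qed

text \<open>The five quadruples form a path starting at (0,0,1,1), each obtained from the previous
  one by a single swap.\<close>

lemma Y_subset_swap_closed:
  assumes "swap_closed A" "{#0, 0, 1, 1#} \<in> A"
  shows "Y \<subseteq> A"
proof -
  have 1: "{#0, 1, 1, 4#} \<in> A"
    using swap_closedD[OF assms(1), of 0 "{#0, 1, 1#}"] assms(2) by (simp add: add_mset_commute)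
  have 2: "{#0, 1, 4, 9#} \<in> A"
    using swap_closedD[OF assms(1), of 1 "{#0, 1, 4#}"] 1 by (simp add: add_mset_commute)
  have 3: "{#1, 4, 4, 9#} \<in> A"
    using swap_closedD[OF assms(1), of 0 "{#1, 4, 9#}"] 2 by (simp add: add_mset_commute)
  have 4: "{#4, 4, 9, 9#} \<in> A"
    using swap_closedD[OF assms(1), of 1 "{#4, 4, 9#}"] 3 by (simp add: add_mset_commute)
  show ?thesis using assms(2) 1 2 3 4 by (simp add: Y_def)
qed

section \<open>The Apollonian group acting on unordered quadruples\<close>

lemma mset_UNIV_4: "mset_set (UNIV :: 4 set) = {#1, 2, 3, 4#}"
  unfolding UNIV_4 by simp

lemma unordered_eq_add_mset:
  "unordered v = add_mset (v $ i) (image_mset (($) v) (mset_set (UNIV - {i})))"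
proof -
  have "mset_set UNIV = add_mset i (mset_set (UNIV - {i}))"
    using mset_set.insert_remove[of UNIV i] by (simp add: insert_absorb)
  then show ?thesis by (simp add: unordered_def)
qed

lemma unordered_S:
  fixes v :: "int ^ 4" and i :: 4
  defines "r \<equiv> image_mset (($) v) (mset_set (UNIV - {i}))"
  shows "unordered (S i v) = add_mset (2 * sum_mset r - v $ i) r"
proof -
  have "image_mset (($) (S i v)) (mset_set (UNIV - {i})) = r"
    unfolding r_def by (rule image_mset_cong) (auto simp: S_def)
  moreover have "S i v $ i = 2 * sum_mset r - v $ i"
    by (simp add: S_def r_def sum_unfold_sum_mset)
  ultimately show ?thesis using unordered_eq_add_mset[of "S i v" i] by simp
qed

lemma S_S: "S i (S i v) = v"
proof -
  have "(\<Sum>k\<in>UNIV - {i}. S i v $ k) = (\<Sum>k\<in>UNIV - {i}. v $ k)"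
    by (rule sum.cong) (auto simp: S_def)
  then show ?thesis by (simp add: vec_eq_iff S_def[of i "S i v"]) (simp add: S_def)
qed

lemma S_in_Bij: "S i \<in> Bij UNIV"
  using involuntory_imp_bij[of "S i"] S_S by (simp add: Bij_def)

lemma inv_S: "inv\<^bsub>BijGroup UNIV\<^esub> S i = S i"
  using inv_BijGroup[OF S_in_Bij, of i] inv_unique_comp[of "S i" "S i"] S_S
  by (auto simp: fun_eq_iff)

lemma apollonian_group_subset_Bij: "apollonian_group \<subseteq> Bij UNIV"
  using group.generate_in_carrier[OF group_BijGroup, of "range S" UNIV] S_in_Bij
  by (auto simp: apollonian_group_def BijGroup_def)

lemma id_in_apollonian_group: "id \<in> apollonian_group"
  using generate.one[of "BijGroup UNIV" "range S"]
  by (simp add: apollonian_group_def BijGroup_def restrict_def id_def)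

lemma comp_in_apollonian_group:
  assumes "g \<in> apollonian_group"
  shows "S i \<circ> g \<in> apollonian_group"
proof -
  have "S i \<otimes>\<^bsub>BijGroup UNIV\<^esub> g \<in> apollonian_group"
    using assms unfolding apollonian_group_def by (metis generate.eng generate.incl rangeI)
  moreover have "S i \<otimes>\<^bsub>BijGroup UNIV\<^esub> g = S i \<circ> g"
    using assms apollonian_group_subset_Bij S_in_Bij by (auto simp: BijGroup_def compose_def fun_eq_iff)
  ultimately show ?thesis by simp
qed

lemma swap_closed_S:
  assumes "swap_closed A" "mod12 (unordered v) \<in> A"
  shows "mod12 (unordered (S i v)) \<in> A"
  using assms unfolding unordered_S unordered_eq_add_mset[of v i]
  by (intro swap_closedD) simp_all

text \<open>Each generator is its own inverse, so closure under swaps already gives closure under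
  the whole group.\<close>

lemma swap_closed_group:
  assumes A: "swap_closed A" and "g \<in> apollonian_group" "mod12 (unordered v) \<in> A"
  shows "mod12 (unordered (g v)) \<in> A"
  using assms(2,3) unfolding apollonian_group_def
proof (induction g arbitrary: v)
  case one
  then show ?case by (simp add: BijGroup_def)
next
  case (incl h)
  then show ?case using swap_closed_S[OF A] by auto
next
  case (inv h)
  then show ?case using swap_closed_S[OF A] by (auto simp: inv_S)
next
  case (eng g h)
  then have "g \<in> Bij UNIV" "h \<in> Bij UNIV"
    using apollonian_group_subset_Bij by (auto simp: apollonian_group_def)
  then have "(g \<otimes>\<^bsub>BijGroup UNIV\<^esub> h) v = g (h v)"
    by (simp add: BijGroup_def compose_def)
  with eng show ?case by simp
qed

lemma swap_closed_orbit12: "swap_closed (orbit12 q)"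
  unfolding swap_closed_def
proof (intro allI impI)
  fix x r assume "mod12 (add_mset x r) \<in> orbit12 q"
  then obtain g v where g: "g \<in> apollonian_group" "mod12 (unordered v) = mod12 q"
    and eq: "mod12 (add_mset x r) = mod12 (unordered (g v))"
    by (auto simp: orbit12_def)
  have "x mod 12 \<in># mod12 (unordered (g v))" unfolding eq[symmetric] by simp
  \<comment> \<open>The swapped entry is known only by its residue; any coordinate of
    \<open>g v\<close> with this residue will do, and S_i after g realises the swap.\<close>
  then obtain i where i: "x mod 12 = g v $ i mod 12" by (auto simp: mod12_def unordered_def)
  define r' where "r' = image_mset (($) (g v)) (mset_set (UNIV - {i}))"
  have "mod12 r = mod12 r'"
    using eq i unordered_eq_add_mset[of "g v" i] by (simp add: r'_def)
  then have "mod12 (add_mset (2 * sum_mset r - x) r) = mod12 (unordered ((S i \<circ> g) v))"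
    using swap_mod12_cong[of r r' x "g v $ i"] i unordered_S[of i "g v"] by (simp add: r'_def)
  then show "mod12 (add_mset (2 * sum_mset r - x) r) \<in> orbit12 q"
    using g comp_in_apollonian_group unfolding orbit12_def by blast
qed

text \<open>The image of \<open>Y\<close> is closed under swaps and contains the starting quadruple,
  hence contains the orbit. Conversely, the orbit pulled back by the inverse map is closed under
  swaps and contains (0,0,1,1), hence contains \<open>Y\<close>.\<close>

lemma affine12_Y_eq_orbit12:
  assumes k: "3 dvd k" and e: "e \<in> {1, - 1}"
  shows "affine12 k e ` Y = orbit12 (affine12 k e {#0, 0, 1, 1#})"
proof
  let ?q = "affine12 k e {#0, 0, 1, 1#}" and ?k = "- (e * k)"
  have red: "mod12 q = q" if "q \<in> orbit12 ?q" for q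
    using that by (auto simp: orbit12_def)
  have mod_q: "mod12 ?q = ?q" by (simp add: affine12_def)
  define v :: "int ^ 4" where "v = (\<chi> i. if i = 1 \<or> i = 2 then k else k + e)"
  have "mod12 (unordered v) = ?q"
    by (simp add: v_def unordered_def affine12_def mset_UNIV_4)
  then have "?q \<in> orbit12 ?q"
    using id_in_apollonian_group mod_q by (force simp: orbit12_def)
  then have "affine12 ?k e ?q \<in> affine12 ?k e ` orbit12 ?q" by blast
  moreover have "affine12 ?k e ?q = {#0, 0, 1, 1#}" using affine12_inverse(2)[OF e] by simp
  moreover have "swap_closed (affine12 ?k e ` orbit12 ?q)"
    using k e red by (intro swap_closed_affine swap_closed_orbit12) auto
  ultimately have "Y \<subseteq> affine12 ?k e ` orbit12 ?q" using Y_subset_swap_closed by simp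
  then have "affine12 k e ` Y \<subseteq> affine12 k e ` affine12 ?k e ` orbit12 ?q" by blast
  also have "\<dots> = orbit12 ?q" using affine12_inverse(1)[OF e] red by (simp add: image_image)
  finally show "affine12 k e ` Y \<subseteq> orbit12 ?q" .
  have "swap_closed (affine12 k e ` Y)"
    using swap_closed_affine[OF swap_closed_Y mod12_Y k e] .
  moreover have "?q \<in> affine12 k e ` Y" by (simp add: Y_def)
  ultimately show "orbit12 ?q \<subseteq> affine12 k e ` Y"
    using swap_closed_group mod_q by (auto simp: orbit12_def)
qed

section \<open>The four orbits and how they are told apart\<close>

definition residue_orbits :: "int multiset set set" where
  "residue_orbits = {affine12 0 1 ` Y, affine12 3 (- 1) ` Y, affine12 6 1 ` Y, affine12 9 (- 1) ` Y}"

lemma residue_orbits_eq: "residue_orbits = {Y, const_minus 3 Y, const_plus 6 Y, const_minus 9 Y}"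
proof -
  have "affine12 0 1 ` Y = Y" by (simp add: affine12_0_1 mod12_Y)
  then show ?thesis
    unfolding residue_orbits_def by (simp add: const_plus_def const_minus_def affine12_def)
qed

lemma residue_orbits_subset: "residue_orbits \<subseteq> orbits12"
proof -
  have "affine12 k e ` Y \<in> orbits12" if "3 dvd k" "e \<in> {1, - 1}" for k e
  proof -
    have "size (affine12 k e {#0, 0, 1, 1#}) = 4" by (simp add: affine12_def)
    then show ?thesis unfolding affine12_Y_eq_orbit12[OF that] orbits12_def by blast
  qed
  then show ?thesis by (simp add: residue_orbits_def)
qed

definition residues_of :: "int multiset set \<Rightarrow> int set" where
  "residues_of U = (\<Union>q\<in>U. set_mset q)"

lemma residues_of_orbits:
  "residues_of (affine12 0 1 ` Y) = {0, 1, 4, 9}"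
  "residues_of (affine12 3 (- 1) ` Y) = {2, 3, 6, 11}"
  "residues_of (affine12 6 1 ` Y) = {3, 6, 7, 10}"
  "residues_of (affine12 9 (- 1) ` Y) = {0, 5, 8, 9}"
  by (auto simp: residues_of_def Y_def affine12_def)

lemma card_residue_orbits: "card residue_orbits = 4"
proof -
  have "card {{0, 1, 4, 9}, {2, 3, 6, 11}, {3, 6, 7, 10}, {0, 5, 8, 9 :: int}} = 4"
    by (simp add: card_insert_if set_eq_subset)
  moreover have "residues_of ` residue_orbits = {{0, 1, 4, 9}, {2, 3, 6, 11}, {3, 6, 7, 10}, {0, 5, 8, 9}}"
    by (simp add: residue_orbits_def residues_of_orbits)
  moreover have "finite residue_orbits" by (simp add: residue_orbits_def)
  ultimately have "card residue_orbits \<ge> 4" using card_image_le by metis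
  moreover have "card residue_orbits \<le> 4"
    unfolding residue_orbits_def
    using card_length[of "[affine12 0 1 ` Y, affine12 3 (- 1) ` Y, affine12 6 1 ` Y, affine12 9 (- 1) ` Y]"] by simp
  ultimately show ?thesis by simp
qed

text \<open>The residue sets of two different orbits share at most 0 and 9, or 3 and 6. These are
  multiples of 3, and every quadruple in the four orbits has at most two such entries.\<close>

lemma residue_orbit_determined:
  assumes "U \<in> residue_orbits" "U' \<in> residue_orbits" "add_mset x r \<in> U" "set_mset r \<subseteq> residues_of U'"
  shows "U = U'"
proof -
  have "U = U' \<or> (\<forall>q\<in>U. \<forall>x\<in>#q. \<not> set_mset (q - {#x#}) \<subseteq> residues_of U')"
    using assms(1,2) unfolding residue_orbits_def
    by (elim insertE emptyE)
      (hypsubst, (rule disjI1, rule refl | rule disjI2, unfold residues_of_orbits, simp add: Y_def affine12_def; fail))+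
  then show ?thesis
  proof
    assume "\<forall>q\<in>U. \<forall>x\<in>#q. \<not> set_mset (q - {#x#}) \<subseteq> residues_of U'"
    from this[rule_format, OF assms(3), of x] assms(4) show ?thesis by simp
  qed
qed

section \<open>Placing a primitive quadruple in an orbit\<close>

lemma mod_12_eqI:
  fixes x :: int
  assumes "x mod 4 = r mod 4" "x mod 3 = r mod 3"
  shows "x mod 12 = r mod 12"
proof -
  have "coprime 4 (3::int)" by (simp add: coprime_iff_gcd_eq_1 gcd_non_0_int)
  then show ?thesis using coprime_cong_mult[of x r 4 3] assms by (simp add: cong_def)
qed

text \<open>By the Chinese remainder theorem the even entries are 0 or 4 and the odd ones 9 or 1.
  Having two or three entries nonzero modulo 3 leaves exactly the five quadruples of
  \<open>Y\<close>.\<close>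

lemma mod12_in_Y:
  assumes "a mod 4 = 0" "b mod 4 = 0" "c mod 4 = 1" "d mod 4 = 1"
    and "\<forall>x\<in>{a, b, c, d}. x mod 3 \<in> {0, 1}"
    and "a mod 3 + b mod 3 + c mod 3 + d mod 3 \<in> {2, 3}"
  shows "mod12 {#a, b, c, d#} \<in> Y"
proof -
  have even: "x mod 12 = (if x mod 3 = 0 then 0 else 4)" if "x mod 4 = 0" "x mod 3 \<in> {0, 1}" for x :: int
  proof -
    have "x mod 12 = (if x mod 3 = 0 then 0 else 4) mod 12"
      using that by (intro mod_12_eqI) auto
    then show ?thesis by simp
  qed
  have odd: "x mod 12 = (if x mod 3 = 0 then 9 else 1)" if "x mod 4 = 1" "x mod 3 \<in> {0, 1}" for x :: int
  proof -
    have "x mod 12 = (if x mod 3 = 0 then 9 else 1) mod 12"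
      using that by (intro mod_12_eqI) auto
    then show ?thesis by simp
  qed
  have m: "a mod 3 \<in> {0,1}" "b mod 3 \<in> {0,1}" "c mod 3 \<in> {0,1}" "d mod 3 \<in> {0,1}"
    using assms(5) by auto
  note r = even[OF assms(1) m(1)] even[OF assms(2) m(2)] odd[OF assms(3) m(3)] odd[OF assms(4) m(4)]
  show ?thesis
    using m assms(6) unfolding Y_def mod12_add_mset mod12_empty r
    by (elim insertE emptyE) (simp_all add: add_mset_commute)
qed

lemma descartes_primitive_mod12:
  assumes "descartes_primitive q"
  shows "\<exists>U\<in>residue_orbits. mod12 q \<in> U"
proof -
  obtain a b c d where q: "q = {#a, b, c, d#}" and par: "even a" "even b" "odd c" "odd d"
    using descartes_primitive_split[OF assms] .
  have eq: "2 * (a\<^sup>2 + b\<^sup>2 + c\<^sup>2 + d\<^sup>2) = (a + b + c + d)\<^sup>2" "a + b + c + d > 0"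
    and prim: "Gcd {a, b, c, d} = 1"
    using assms unfolding descartes_primitive_def q by (simp_all add: algebra_simps)
  have "2 * (a\<^sup>2 + c\<^sup>2 + b\<^sup>2 + d\<^sup>2) = (a + c + b + d)\<^sup>2" "a + c + b + d > 0" "Gcd {a, c, b, d} = 1"
    using eq prim by (simp_all add: algebra_simps insert_commute)
  from descartes_mod_4[OF eq(1) par descartes_pair_not_3_mod_4[OF this]]
  have m4: "a mod 4 = b mod 4" "c mod 4 = d mod 4" "c mod 4 = a mod 4 + 1" .
  obtain e where e: "e \<in> {1, - 1}"
    and m3: "\<forall>x\<in>{a, b, c, d}. (e * x) mod 3 \<in> {0, 1}"
    "(e * a) mod 3 + (e * b) mod 3 + (e * c) mod 3 + (e * d) mod 3 \<in> {2, 3}"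
    using descartes_mod_3[OF eq(1) prim] by blast
  have tr: "(e * (x - k)) mod 3 = (e * x) mod 3" if k: "k mod 3 = 0" for k x
  proof -
    obtain j where "k = 3 * j" using mod_0_imp_dvd[OF k] by (rule dvdE)
    then have "e * (x - k) = e * x + (- (e * j)) * 3" by (simp add: algebra_simps)
    then show ?thesis by (simp only: mod_mult_self1)
  qed
  have diff: "(x - y) mod 4 = 0" if "x mod 4 = y mod 4" for x y :: int
    using that by (simp add: mod_eq_dvd_iff)
  have diff1: "(x - y) mod 4 = 1" if "x mod 4 = y mod 4 + 1" for x y :: int
    by (subst mod_diff_eq[symmetric]) (simp add: that)
  have "a mod 4 = 0 \<or> a mod 4 = 2" using par(1) by presburger
  with m4(3) have "a mod 4 = 0 \<and> c mod 4 = 1 \<or> a mod 4 = 2 \<and> c mod 4 = 3" by linarith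
  moreover have "affine12 0 1 ` Y \<in> residue_orbits" "affine12 9 (- 1) ` Y \<in> residue_orbits"
    "affine12 6 1 ` Y \<in> residue_orbits" "affine12 3 (- 1) ` Y \<in> residue_orbits"
    unfolding residue_orbits_def by blast+
  moreover have "e = 1 \<or> e = - 1" using e by simp
  ultimately consider "e = 1" "a mod 4 = 0" "affine12 0 e ` Y \<in> residue_orbits"
    | "e = 1" "a mod 4 = 2" "affine12 6 e ` Y \<in> residue_orbits"
    | "e = - 1" "c mod 4 = 1" "affine12 9 e ` Y \<in> residue_orbits"
    | "e = - 1" "c mod 4 = 3" "affine12 3 e ` Y \<in> residue_orbits"
    by blast
  \<comment> \<open>The sign \<open>e\<close> comes from the residues modulo 3. The shift
    \<open>k\<close> is a multiple of 3, so it leaves those untouched, and is chosen modulo 4 to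
    send the pair that should become 0 there: \<open>a\<close>, \<open>b\<close> if
    \<open>e = 1\<close>, and \<open>c\<close>, \<open>d\<close> if \<open>e = - 1\<close>, as
    negation exchanges the roles of the pairs.\<close>
  then obtain k where k: "k \<in> {0, 3, 6, 9}" "affine12 k e ` Y \<in> residue_orbits"
    "e = 1 \<and> k mod 4 = a mod 4 \<or> e = - 1 \<and> k mod 4 = c mod 4"
  proof cases
    case 1 then show thesis by (intro that[of 0]) simp_all
  next
    case 2 then show thesis by (intro that[of 6]) simp_all
  next
    case 3 then show thesis by (intro that[of 9]) simp_all
  next
    case 4 then show thesis by (intro that[of 3]) simp_all
  qed
  have k3: "k mod 3 = 0" using k(1) by auto
  let ?f = "\<lambda>x. e * (x - k)"
  have f3: "\<forall>x\<in>{?f a, ?f b, ?f c, ?f d}. x mod 3 \<in> {0, 1}"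
    "?f a mod 3 + ?f b mod 3 + ?f c mod 3 + ?f d mod 3 \<in> {2, 3}"
    using m3 unfolding ball_simps tr[OF k3] .
  have "mod12 (image_mset ?f q) \<in> Y"
    using k(3)
  proof
    assume "e = 1 \<and> k mod 4 = a mod 4"
    then have e1: "e = 1" and k4: "k mod 4 = a mod 4" by auto
    have "?f a mod 4 = 0" "?f b mod 4 = 0" "?f c mod 4 = 1" "?f d mod 4 = 1"
      using k4 m4 unfolding e1 by (simp_all add: diff diff1)
    from mod12_in_Y[OF this f3] show ?thesis by (simp add: q)
  next
    assume "e = - 1 \<and> k mod 4 = c mod 4"
    then have e1: "e = - 1" and k4: "k mod 4 = c mod 4" by auto
    have f4: "?f c mod 4 = 0" "?f d mod 4 = 0" "?f a mod 4 = 1" "?f b mod 4 = 1"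
      using k4 m4 unfolding e1 by (simp_all add: diff diff1)
    have "\<forall>x\<in>{?f c, ?f d, ?f a, ?f b}. x mod 3 \<in> {0, 1}"
      "?f c mod 3 + ?f d mod 3 + ?f a mod 3 + ?f b mod 3 \<in> {2, 3}"
      using f3 by (simp_all only: ball_simps ac_simps)
    from mod12_in_Y[OF f4 this] show ?thesis by (simp add: q add_mset_commute)
  qed
  then have "affine12 (- (e * k)) e q \<in> Y" by (simp add: affine12_def algebra_simps)
  then have "mod12 q \<in> affine12 k e ` Y" by (rule mod12_in_affine_image[OF e])
  with k(2) show ?thesis by blast
qed

section \<open>Packings\<close>

text \<open>The floor only changes the type: in an integral packing every curvature is an
  integer.\<close>

definition int_quadruple :: "gcircle set \<Rightarrow> int multiset" where
  "int_quadruple D = image_mset (\<lambda>C. \<lfloor>curvature C\<rfloor>) (mset_set D)"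

context
  fixes P
  assumes P: "primitive_integral_packing P"
    and pos: "\<And>q. q \<in> descartes_quadruples P \<Longrightarrow> sum_mset q > 0"
begin

lemma of_int_floor_curvature: "C \<in> P \<Longrightarrow> of_int \<lfloor>curvature C\<rfloor> = curvature C"
  using P by (auto simp: primitive_integral_packing_def integral_packing_def elim!: Ints_cases)

lemma descartes_quadruples_eq:
  "descartes_quadruples P = int_quadruple ` {D. D \<subseteq> P \<and> descartes_configuration D}"
proof (intro equalityI subsetI)
  fix q assume "q \<in> descartes_quadruples P"
  then obtain D where D: "D \<subseteq> P" "descartes_configuration D"
    "image_mset of_int q = image_mset curvature (mset_set D)"
    by (auto simp: descartes_quadruples_def curvature_quadruples_def)
  have "q = image_mset (\<lambda>x. \<lfloor>x :: real\<rfloor>) (image_mset of_int q)"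
    by (simp add: multiset.map_comp o_def)
  also have "\<dots> = int_quadruple D"
    unfolding D(3) by (simp add: multiset.map_comp o_def int_quadruple_def)
  finally show "q \<in> int_quadruple ` {D. D \<subseteq> P \<and> descartes_configuration D}" using D by blast
next
  fix q assume "q \<in> int_quadruple ` {D. D \<subseteq> P \<and> descartes_configuration D}"
  then obtain D where D: "D \<subseteq> P" "descartes_configuration D" "q = int_quadruple D" by blast
  have "finite D" using D(2) by (simp add: descartes_configuration_def card_ge_0_finite)
  then have "image_mset of_int q = image_mset curvature (mset_set D)"
    using D(1) of_int_floor_curvature unfolding D(3) int_quadruple_def multiset.map_comp
    by (intro image_mset_cong) auto
  with D show "q \<in> descartes_quadruples P"
    by (auto simp: descartes_quadruples_def curvature_quadruples_def)
qed

lemma descartes_primitive_int_quadruple: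
  assumes D: "D \<subseteq> P" "descartes_configuration D"
  shows "descartes_primitive (int_quadruple D)"
proof -
  have mem: "int_quadruple D \<in> descartes_quadruples P"
    using D unfolding descartes_quadruples_eq by blast
  have "card D = 4" using D(2) by (simp add: descartes_configuration_def)
  then have size: "size (int_quadruple D) = 4" by (simp add: int_quadruple_def)
  have floor: "(\<Sum>C\<in>D. f (of_int \<lfloor>curvature C\<rfloor>)) = (\<Sum>C\<in>D. f (curvature C))" for f :: "real \<Rightarrow> real"
    using D(1) of_int_floor_curvature by (intro sum.cong refl arg_cong[of _ _ f]) blast
  have "2 * (\<Sum>C\<in>D. (of_int \<lfloor>curvature C\<rfloor> :: real)\<^sup>2) = (\<Sum>C\<in>D. of_int \<lfloor>curvature C\<rfloor>)\<^sup>2"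
    unfolding floor[of "\<lambda>x. x\<^sup>2"] floor[of "\<lambda>x. x"] by (rule descartes_circle_theorem[OF D(2)])
  then have "real_of_int (2 * (\<Sum>C\<in>D. \<lfloor>curvature C\<rfloor>\<^sup>2)) = real_of_int ((\<Sum>C\<in>D. \<lfloor>curvature C\<rfloor>)\<^sup>2)"
    by simp
  then have "2 * (\<Sum>C\<in>D. \<lfloor>curvature C\<rfloor>\<^sup>2) = (\<Sum>C\<in>D. \<lfloor>curvature C\<rfloor>)\<^sup>2"
    by (simp only: of_int_eq_iff)
  then have "2 * (\<Sum>x\<in>#int_quadruple D. x\<^sup>2) = (sum_mset (int_quadruple D))\<^sup>2"
    by (simp add: int_quadruple_def multiset.map_comp o_def sum_unfold_sum_mset)
  then show ?thesis
    using size mem pos P by (simp add: descartes_primitive_def primitive_integral_packing_def)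
qed

text \<open>The invariant concerns single circles because the packing is generated circle by circle,
  whereas a configuration inside it need not be one used in a filling step. Three old circles fix
  the orbit of the completed quadruple, and so the residue of the new curvature.\<close>

lemma curvature_residues_same_orbit:
  assumes gen: "P = generated_packing D"
    and U: "U \<in> residue_orbits" "mod12 (int_quadruple D) \<in> U" and D: "finite D"
    and C: "C \<in> P"
  shows "\<lfloor>curvature C\<rfloor> mod 12 \<in> residues_of U"
  using C[unfolded gen]
proof (induction rule: generated_packing.induct)
  case (init C)
  then have "\<lfloor>curvature C\<rfloor> mod 12 \<in># mod12 (int_quadruple D)"
    using D by (auto simp: mod12_def int_quadruple_def)
  then show ?case using U(2) by (auto simp: residues_of_def)
next
  case (fill C1 C2 C3 C)
  let ?D = "{C1, C2, C3, C}" and ?k = "\<lambda>C. \<lfloor>curvature C\<rfloor>"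
  \<comment> \<open>Cardinality 4 makes the circles distinct, so that the multiset of curvatures has
    four entries, repeated values included.\<close>
  have "card ?D = 4" using fill.hyps by (simp add: descartes_configuration_def)
  then have "distinct [C, C1, C2, C3]"
    by (intro card_distinct) (simp add: insert_commute)
  then have q: "int_quadruple ?D = {#?k C, ?k C1, ?k C2, ?k C3#}"
    by (auto simp: int_quadruple_def add_mset_commute)
  have "C \<in> P" unfolding gen using fill.hyps by (rule generated_packing.fill)
  then have "?D \<subseteq> P" using fill.hyps gen by simp
  from descartes_primitive_mod12[OF descartes_primitive_int_quadruple[OF this fill.hyps(4)]]
  obtain U' where U': "U' \<in> residue_orbits" "mod12 (int_quadruple ?D) \<in> U'" by blast
  have mem: "add_mset (?k C mod 12) {#?k C1 mod 12, ?k C2 mod 12, ?k C3 mod 12#} \<in> U'"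
    using U'(2) unfolding q by simp
  then have "U' = U"
    by (rule residue_orbit_determined[OF U'(1) U(1)]) (simp add: fill.IH)
  then show ?case
    unfolding residues_of_def using mem by (blast intro: union_single_eq_member)
qed

lemma ex1_residue_orbit:
  "\<exists>!U. U \<in> residue_orbits \<and> (\<forall>q\<in>descartes_quadruples P. mod12 q \<in> U)"
proof -
  obtain D where D: "descartes_configuration D" and gen: "P = generated_packing D"
    using P by (auto simp: primitive_integral_packing_def integral_packing_def apollonian_packing_def)
  have sub: "D \<subseteq> P" unfolding gen by (auto intro: generated_packing.init)
  have fin: "finite D'" if "descartes_configuration D'" for D'
    using that by (simp add: descartes_configuration_def card_ge_0_finite)
  obtain U where U: "U \<in> residue_orbits" "mod12 (int_quadruple D) \<in> U"
    using descartes_primitive_mod12[OF descartes_primitive_int_quadruple[OF sub D]] by blast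
  \<comment> \<open>Used twice: for existence with an arbitrary configuration of the packing, and
    for uniqueness with the initial one.\<close>
  have same: "U' = U" if "U' \<in> residue_orbits" "mod12 (int_quadruple D') \<in> U'"
    and D': "D' \<subseteq> P" "descartes_configuration D'" for U' D'
  proof -
    have "size (mod12 (int_quadruple D')) = Suc 3"
      using D'(2) by (simp add: int_quadruple_def descartes_configuration_def)
    then obtain x r where xr: "mod12 (int_quadruple D') = add_mset x r"
      by (metis size_eq_Suc_imp_eq_union)
    have "set_mset (mod12 (int_quadruple D')) \<subseteq> residues_of U"
      using curvature_residues_same_orbit[OF gen U fin[OF D]] D'(1) fin[OF D'(2)]
      by (auto simp: mod12_def int_quadruple_def)
    then show ?thesis
      using that(2) unfolding xr by (intro residue_orbit_determined[OF that(1) U(1)]) auto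
  qed
  show ?thesis
  proof (rule ex1I[of _ U])
    have "mod12 q \<in> U" if "q \<in> descartes_quadruples P" for q
    proof -
      from that obtain D' where D': "D' \<subseteq> P" "descartes_configuration D'" "q = int_quadruple D'"
        unfolding descartes_quadruples_eq by blast
      with descartes_primitive_mod12[OF descartes_primitive_int_quadruple[OF D'(1,2)]] same
      show ?thesis by blast
    qed
    with U(1) show "U \<in> residue_orbits \<and> (\<forall>q\<in>descartes_quadruples P. mod12 q \<in> U)" by blast
  next
    fix U' assume "U' \<in> residue_orbits \<and> (\<forall>q\<in>descartes_quadruples P. mod12 q \<in> U')"
    then show "U' = U" using same[OF _ _ sub D] sub D unfolding descartes_quadruples_eq by blast
  qed
qed

end

theorem theorem6p1:
  shows "{Y, const_minus 3 Y, const_plus 6 Y, const_minus 9 Y} \<subseteq> orbits12 \<and>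
    card {Y, const_minus 3 Y, const_plus 6 Y, const_minus 9 Y} = 4 \<and>
    (\<forall>P. primitive_integral_packing P \<and> (\<forall>q\<in>descartes_quadruples P. sum_mset q > 0) \<longrightarrow>
      (\<exists>!U. U \<in> {Y, const_minus 3 Y, const_plus 6 Y, const_minus 9 Y} \<and>
            (\<forall>q\<in>descartes_quadruples P. mod12 q \<in> U)))"
  unfolding residue_orbits_eq[symmetric]
  using residue_orbits_subset card_residue_orbits ex1_residue_orbit by blast

end
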